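(* Let $d$ be either $0$ or a positive square-free integer, $K=\mathbb{Q}(\sqrt{-d})$, $R$ the ring of integers of $K$. For each integer $n\geq1$, the graphs $\Gamma_{1,n}$ and $\Gamma^{un}_{2,n}$ are cographs, i.e. neither contains the path graph $P_4$ on four vertices as an induced subgraph.
   Context: The zero-divisor graph $\Gamma(M_2(R))$ is the directed graph whose vertices are the nonzero (left or right) zero-divisors of $M_2(R)$, with an edge $v_1\to v_2$ between distinct vertices iff $v_1v_2=0$. For an integer $N\geq1$ and $t\in R$, let $S_{tc,1,t,N}=\{\lambda\begin{bmatrix}1&t\\t^2&t^3\end{bmatrix}:\lambda\in\mathbb{Z},\,1\leq|\lambda|\leq N\}$ and $S_{tc,2,N}=\{\begin{bmatrix}0&0\\0&\lambda\end{bmatrix}:\lambda\in\mathbb{Z},\,1\leq|\lambda|\leq N\}$. Let $\Gamma_{1,N}$ be the induced subgraph of $\Gamma(M_2(R))$ on $S_{tc,1,0,N}\cup S_{tc,2,N}$, regarded as an undirected graph. Let $U=\{\pm1\}$ if $d\neq1,3$, $U=\{\pm1,\pm i\}$ if $d=1$ ($i=\sqrt{-1}$), $U=\{\pm1,\pm\omega,\pm\omega^2\}$ if $d=3$ ($\omega$ a primitive third root of unity); let $\Gamma_{2,N}$ be the induced subgraph of $\Gamma(M_2(R))$ on $\bigcup_{j\in U}S_{tc,1,j,N}$, and $\Gamma^{un}_{2,N}$ its underlying undirected graph (distinct $v_1,v_2$ adjacent iff $v_1v_2=0$ or $v_2v_1=0$). *)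

theory Defs
  imports
    "HOL-Analysis.Analysis"
    "HOL-Computational_Algebra.Computational_Algebra"
    "Graph_Theory.Graph_Theory"
begin

definition quad_field :: "nat \<Rightarrow> complex set" where
  "quad_field d = {of_rat a + of_rat b * csqrt (- of_nat d) | a b. True}"

definition quad_integers :: "nat \<Rightarrow> complex set" where
  "quad_integers d = {x \<in> quad_field d. algebraic_int x}"

definition mat2 :: "complex set \<Rightarrow> (complex^2^2) set" where
  "mat2 R = {A. \<forall>i j. A $ i $ j \<in> R}"

definition nonzero_zero_divisors :: "complex set \<Rightarrow> (complex^2^2) set" where
  "nonzero_zero_divisors R =
     {A \<in> mat2 R. A \<noteq> 0 \<and> (\<exists>B \<in> mat2 R. B \<noteq> 0 \<and> (A ** B = 0 \<or> B ** A = 0))}"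

definition zero_divisor_graph :: "complex set \<Rightarrow> (complex^2^2) pair_pre_digraph" where
  "zero_divisor_graph R =
     \<lparr> pverts = nonzero_zero_divisors R,
       parcs = {(A, B). A \<in> nonzero_zero_divisors R \<and> B \<in> nonzero_zero_divisors R
                  \<and> A \<noteq> B \<and> A ** B = 0} \<rparr>"

definition S_tc1 :: "complex \<Rightarrow> nat \<Rightarrow> (complex^2^2) set" where
  "S_tc1 t N = {of_int l *\<^sub>R vector [vector [1, t], vector [t^2, t^3]] | l :: int.
                  1 \<le> \<bar>l\<bar> \<and> \<bar>l\<bar> \<le> int N}"

definition S_tc2 :: "nat \<Rightarrow> (complex^2^2) set" where
  "S_tc2 N = {vector [vector [0, 0], vector [0, of_int l]] | l :: int.
                1 \<le> \<bar>l\<bar> \<and> \<bar>l\<bar> \<le> int N}"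

definition omega :: complex where
  "omega = cis (2 * pi / 3)"

definition unit_params :: "nat \<Rightarrow> complex set" where
  "unit_params d =
     (if d = 1 then {1, -1, \<i>, -\<i>}
      else if d = 3 then {1, -1, omega, -omega, omega^2, -(omega^2)}
      else {1, -1})"

(* Undirected graphs are digraphs with a symmetric arc set; mk_symmetric forgets orientation. *)

definition Gamma1 :: "nat \<Rightarrow> nat \<Rightarrow> (complex^2^2) pair_pre_digraph" where
  "Gamma1 d N =
     mk_symmetric (with_proj (zero_divisor_graph (quad_integers d)) \<restriction> (S_tc1 0 N \<union> S_tc2 N))"

definition Gamma2 :: "nat \<Rightarrow> nat \<Rightarrow> (complex^2^2, (complex^2^2) \<times> (complex^2^2)) pre_digraph" where
  "Gamma2 d N =
     with_proj (zero_divisor_graph (quad_integers d)) \<restriction> (\<Union>j \<in> unit_params d. S_tc1 j N)"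

definition Gamma2_un :: "nat \<Rightarrow> nat \<Rightarrow> (complex^2^2) pair_pre_digraph" where
  "Gamma2_un d N = mk_symmetric (Gamma2 d N)"

definition path4 :: "nat pair_pre_digraph" where
  "path4 = \<lparr> pverts = {0, 1, 2, 3},
             parcs = {(0, 1), (1, 0), (1, 2), (2, 1), (2, 3), (3, 2)} \<rparr>"

definition cograph :: "'a pair_pre_digraph \<Rightarrow> bool" where
  "cograph G \<longleftrightarrow>
     \<not> (\<exists>H. induced_subgraph H (with_proj G) \<and> digraph_iso H (with_proj path4))"

end

theory Submission
  imports Defs
begin

text \<open>The matrix with parameter \<open>t\<close> is the rank-one product of the column \<open>(1, t\<^sup>2)\<close> and the row
  \<open>(1, t)\<close>, so the matrices with parameters \<open>s\<close> and \<open>t\<close> multiply to zero iff \<open>s * t\<^sup>2 = -1\<close>. Adjacency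
  therefore depends on the parameters only. On sixth roots of unity \<open>s\<close> and \<open>t\<close> are related iff
  \<open>t = s\<close> or \<open>t = -s\<close>, and not both have cube \<open>1\<close>; on fourth roots of unity the parameter \<open>1\<close> is
  related to exactly the three others, and among those only \<open>-1\<close> is related to itself. Neither
  relation leaves room for an induced path on four vertices. The graph \<open>\<Gamma>\<^sub>1\<close> is complete
  bipartite.\<close>

text \<open>An isomorphism onto \<open>path4\<close> pulls \<open>0, 1, 2, 3\<close> back to
  vertices \<open>a, b, c, e\<close> of \<open>G\<close> joined by three arcs and by no chord, so
  forcing a chord excludes it.\<close>

lemma cographI:
  assumes "\<And>a b c e. (a, b) \<in> parcs G \<Longrightarrow> (b, c) \<in> parcs G \<Longrightarrow> (c, e) \<in> parcs G \<Longrightarrow>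
      a \<noteq> c \<Longrightarrow> b \<noteq> e \<Longrightarrow> a \<noteq> e \<Longrightarrow> (a, c) \<in> parcs G \<or> (b, e) \<in> parcs G \<or> (a, e) \<in> parcs G"
  shows "cograph G"
  unfolding cograph_def
proof
  assume "\<exists>H. induced_subgraph H (with_proj G) \<and> digraph_iso H (with_proj path4)"
  then obtain H f where H: "induced_subgraph H (with_proj G)"
    and f: "pre_digraph.digraph_isomorphism H f" and p: "with_proj path4 = app_iso f H"
    by (auto simp: digraph_iso_def)
  define v where "v = iso_verts f"
  \<comment> \<open>This is where inducedness enters: a missing arc of \<open>H\<close> is also
    missing in \<open>G\<close>.\<close>
  have H_ends: "arcs_ends H = {(x, y) \<in> parcs G. x \<in> verts H \<and> y \<in> verts H}"
    using H by (auto simp: induced_subgraph_def subgraph_def compatible_def arcs_ends_conv)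
  have ends: "parcs path4 = (\<lambda>(x, y). (v x, v y)) ` arcs_ends H"
    using wf_digraph.arcs_ends_app_iso_eq[OF _ f] f p
    by (metis v_def with_proj_simps(3) pre_digraph.digraph_isomorphism_def)
  have inj: "inj_on v (verts H)"
    using f by (simp add: v_def pre_digraph.digraph_isomorphism_def)
  have "pverts path4 = v ` verts H"
    using p by (metis v_def verts_app_iso with_proj_simps(1))
  then have "{0, 1, 2, 3} \<subseteq> v ` verts H"
    by (simp add: path4_def)
  then obtain a b c e where V: "a \<in> verts H" "b \<in> verts H" "c \<in> verts H" "e \<in> verts H"
    and v: "v a = 0" "v b = 1" "v c = 2" "v e = 3"
    by (auto simp: image_iff)
  have arc: "(x, y) \<in> parcs G \<longleftrightarrow> (v x, v y) \<in> parcs path4"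
    if "x \<in> verts H" "y \<in> verts H" for x y
    unfolding ends H_ends using that by (auto simp: image_iff inj_on_eq_iff[OF inj])
  have "a \<noteq> c" "b \<noteq> e" "a \<noteq> e"
    using v by auto
  then show False
    using assms[of a b c e] v by (auto simp: arc V path4_def)
qed

text \<open>The given arcs already make all four matrices zero divisors, and \<open>cographI\<close>
  supplies the distinctness that turns a zero product into an arc; only products within
  \<open>S\<close> remain to be studied.\<close>

lemma cograph_induced_zero_divisor_graph:
  assumes "\<And>A B C D. A \<in> S \<Longrightarrow> B \<in> S \<Longrightarrow> C \<in> S \<Longrightarrow> D \<in> S \<Longrightarrow>
      A ** B = 0 \<or> B ** A = 0 \<Longrightarrow> B ** C = 0 \<or> C ** B = 0 \<Longrightarrow> C ** D = 0 \<or> D ** C = 0 \<Longrightarrow>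
      (A ** C = 0 \<or> C ** A = 0) \<or> (B ** D = 0 \<or> D ** B = 0) \<or> (A ** D = 0 \<or> D ** A = 0)"
  shows "cograph (mk_symmetric (with_proj (zero_divisor_graph R) \<restriction> S))" (is "cograph ?G")
proof (rule cographI)
  have arc: "(A, B) \<in> parcs ?G \<longleftrightarrow>
      A \<in> nonzero_zero_divisors R \<and> B \<in> nonzero_zero_divisors R \<and> A \<in> S \<and> B \<in> S \<and> A \<noteq> B
      \<and> (A ** B = 0 \<or> B ** A = 0)" for A B
    by (auto simp: parcs_mk_symmetric zero_divisor_graph_def)
  show "(A, C) \<in> parcs ?G \<or> (B, D) \<in> parcs ?G \<or> (A, D) \<in> parcs ?G"
    if "(A, B) \<in> parcs ?G" "(B, C) \<in> parcs ?G" "(C, D) \<in> parcs ?G" "A \<noteq> C" "B \<noteq> D" "A \<noteq> D"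
    for A B C D
    using that assms[of A B C D] unfolding arc by blast
qed

lemma S_tc1_mult_eq_0_iff:
  assumes "A \<in> S_tc1 s N" "B \<in> S_tc1 t N"
  shows "A ** B = 0 \<longleftrightarrow> s * t^2 = -1"
proof -
  obtain k :: int where k: "1 \<le> \<bar>k\<bar>"
    and A: "A = of_int k *\<^sub>R vector [vector [1, s], vector [s^2, s^3]]"
    using assms(1) unfolding S_tc1_def by blast
  obtain l :: int where l: "1 \<le> \<bar>l\<bar>"
    and B: "B = of_int l *\<^sub>R vector [vector [1, t], vector [t^2, t^3]]"
    using assms(2) unfolding S_tc1_def by blast
  \<comment> \<open>Row \<open>(1, s)\<close> times column \<open>(1, t^2)\<close> gives the scalar
    in \<open>c\<close>; what is left is column \<open>(1, s^2)\<close> times row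
    \<open>(1, t)\<close>, whose corner entry is 1.\<close>
  have "A ** B = (let c = of_int (k * l) * (1 + s * t^2) in
      vector [vector [c, c * t], vector [c * s^2, c * (s^2 * t)]])"
    by (simp add: A B vec_eq_iff forall_2 matrix_matrix_mult_def sum_2)
       (simp add: scaleR_conv_of_real algebra_simps power2_eq_square power3_eq_cube)
  then have "A ** B = 0 \<longleftrightarrow> 1 + s * t^2 = 0"
    using k l by (auto simp: Let_def vec_eq_iff forall_2)
  then show ?thesis
    by (metis add.commute add_eq_0_iff)
qed

lemma S_tc1_0_S_tc2_mult:
  assumes "A \<in> S_tc1 0 N" "B \<in> S_tc2 N"
  shows "A ** B = 0"
  using assms
  by (auto simp: S_tc1_def S_tc2_def vec_eq_iff forall_2 matrix_matrix_mult_def sum_2)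

lemma S_tc2_mult_neq_0:
  assumes "A \<in> S_tc2 N" "B \<in> S_tc2 N"
  shows "A ** B \<noteq> 0"
  using assms
  by (auto simp: S_tc2_def vec_eq_iff forall_2 matrix_matrix_mult_def sum_2)

lemma cograph_Gamma1: "cograph (Gamma1 d n)"
  unfolding Gamma1_def
proof (rule cograph_induced_zero_divisor_graph)
  let ?S = "S_tc1 0 n \<union> S_tc2 n"
  \<comment> \<open>At \<open>s = t = 0\<close> the criterion reads \<open>0 = -1\<close>. Hence
    each edge changes sides, and three edges put \<open>A\<close> and \<open>D\<close> on opposite
    sides.\<close>
  have adj: "A ** B = 0 \<or> B ** A = 0 \<longleftrightarrow> (A \<in> S_tc1 0 n \<longleftrightarrow> B \<notin> S_tc1 0 n)"
    if "A \<in> ?S" "B \<in> ?S" for A B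
    using that S_tc1_mult_eq_0_iff[of _ 0 n _ 0] S_tc1_0_S_tc2_mult[of _ n] S_tc2_mult_neq_0[of _ n]
    by (metis Un_iff mult_zero_left neg_equal_0_iff_equal zero_neq_one)
  show "(A ** C = 0 \<or> C ** A = 0) \<or> (B ** D = 0 \<or> D ** B = 0) \<or> (A ** D = 0 \<or> D ** A = 0)"
    if "A \<in> ?S" "B \<in> ?S" "C \<in> ?S" "D \<in> ?S" "A ** B = 0 \<or> B ** A = 0"
      "B ** C = 0 \<or> C ** B = 0" "C ** D = 0 \<or> D ** C = 0" for A B C D
    using that by (simp add: adj)
qed

text \<open>Symmetric, since orientation is forgotten. It may hold for \<open>s = t\<close>, as
  distinct matrices can share a parameter.\<close>

definition param_adj :: "complex \<Rightarrow> complex \<Rightarrow> bool" where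
  "param_adj s t \<longleftrightarrow> s * t^2 = -1 \<or> t * s^2 = -1"

lemma param_adj_sixth_roots:
  assumes "s^6 = 1" "t^6 = 1"
  shows "param_adj s t \<longleftrightarrow> (t = s \<or> t = -s) \<and> \<not> (s^3 = 1 \<and> t^3 = 1)"
proof -
  have cube: "x^3 = 1 \<or> x^3 = -1" if "x^6 = 1" for x :: complex
  proof -
    have "(x^3)^2 = 1"
      using that by (simp flip: power_mult)
    then show ?thesis
      by (rule power2_eq_1_iff[THEN iffD1])
  qed
  have iff: "x * y^2 = -1 \<longleftrightarrow> x^3 = -1 \<and> (y = x \<or> y = -x)"
    if x: "x^6 = 1" and y: "y^6 = 1" for x y :: complex
  proof
    assume xy: "x * y^2 = -1"
    \<comment> \<open>Cubing eliminates \<open>y\<close>, because \<open>y^6 = 1\<close>.\<close>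
    then have "(x * y^2)^3 = -1" by simp
    then have x3: "x^3 = -1"
      using y by (simp add: power_mult_distrib flip: power_mult)
    have "x * x^2 = x * y^2"
      using x3 xy by (simp add: power3_eq_cube power2_eq_square mult.assoc)
    moreover have "x \<noteq> 0"
      using x by auto
    ultimately have "y^2 = x^2" by simp
    then show "x^3 = -1 \<and> (y = x \<or> y = -x)"
      using x3 by (simp add: power2_eq_iff)
  next
    assume "x^3 = -1 \<and> (y = x \<or> y = -x)"
    then show "x * y^2 = -1"
      by (auto simp: power3_eq_cube power2_eq_square mult.assoc)
  qed
  show ?thesis
    using iff[of s t] iff[of t s] cube[of s] cube[of t] assms
    unfolding param_adj_def by force
qed

lemma param_adj_fourth_roots:
  assumes "s \<in> {1, -1, \<i>, -\<i>}" "t \<in> {1, -1, \<i>, -\<i>}"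
  shows "param_adj s t \<longleftrightarrow> (s = 1 \<longleftrightarrow> t \<noteq> 1) \<or> s = -1 \<and> t = -1"
proof -
  have [simp]: "\<i> \<noteq> -1" "-\<i> \<noteq> 1" "-\<i> \<noteq> -1"
    by (simp_all add: complex_eq_iff)
  show ?thesis
    using assms by (elim insertE emptyE) (simp_all add: param_adj_def)
qed

text \<open>The case \<open>d = 1\<close> is excluded because \<i> has sixth power -1.\<close>

lemma unit_params_sixth_root:
  assumes "t \<in> unit_params d" "d \<noteq> 1"
  shows "t^6 = 1"
proof -
  have "omega^3 = 1"
    by (simp add: omega_def Complex.DeMoivre)
  moreover have "omega^6 = (omega^3)^2" "(omega^2)^6 = (omega^3)^4"
    by (simp_all flip: power_mult)
  ultimately have "omega^6 = 1" "(omega^2)^6 = 1"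
    by simp_all
  then show ?thesis
    using assms by (auto simp: unit_params_def split: if_splits)
qed

lemma param_adj_P4_free:
  assumes "{a, b, c, e} \<subseteq> unit_params d"
    and "param_adj a b" "param_adj b c" "param_adj c e"
  shows "param_adj a c \<or> param_adj b e \<or> param_adj a e"
proof (cases "d = 1")
  case True
  then have "{a, b, c, e} \<subseteq> {1, -1, \<i>, -\<i>}"
    using assms(1) by (simp add: unit_params_def)
  then have "param_adj x y \<longleftrightarrow> (x = 1 \<longleftrightarrow> y \<noteq> 1) \<or> x = -1 \<and> y = -1"
    if "x \<in> {a, b, c, e}" "y \<in> {a, b, c, e}" for x y
    using that by (intro param_adj_fourth_roots) blast+
  \<comment> \<open>Without two consecutive parameters -1, the path alternates between 1 and the
    rest, so \<open>a\<close> and \<open>e\<close> are related. Otherwise, exchanging two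
    consecutive equal parameters turns a neighbouring edge into a chord.\<close>
  then show ?thesis
    using assms(2-) by auto
next
  case False
  then have "x^6 = 1" if "x \<in> {a, b, c, e}" for x
    using that assms(1) unit_params_sixth_root by blast
  then have adj: "param_adj x y \<longleftrightarrow> (y = x \<or> y = -x) \<and> \<not> (x^3 = 1 \<and> y^3 = 1)"
    if "x \<in> {a, b, c, e}" "y \<in> {a, b, c, e}" for x y
    using that by (intro param_adj_sixth_roots) blast+
  have "b = a \<or> b = -a" "c = b \<or> c = -b" "e = c \<or> e = -c" "\<not> (c^3 = 1 \<and> e^3 = 1)"
    using assms(2-) by (simp_all add: adj)
  \<comment> \<open>All parameters agree up to sign, and \<open>c\<close> or \<open>e\<close> has
    cube different from 1; that one is related to \<open>a\<close>.\<close>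
  then have "(c = a \<or> c = -a) \<and> (e = a \<or> e = -a) \<and> \<not> (c^3 = 1 \<and> e^3 = 1)"
    by auto
  then have "param_adj a c \<or> param_adj a e"
    by (auto simp: adj)
  then show ?thesis by blast
qed

lemma cograph_Gamma2_un: "cograph (Gamma2_un d n)"
  unfolding Gamma2_un_def Gamma2_def
proof (rule cograph_induced_zero_divisor_graph)
  let ?S = "\<Union>j \<in> unit_params d. S_tc1 j n"
  fix A B C D
  assume "A \<in> ?S" "B \<in> ?S" "C \<in> ?S" "D \<in> ?S"
  then obtain a b c e where U: "{a, b, c, e} \<subseteq> unit_params d"
    and S: "A \<in> S_tc1 a n" "B \<in> S_tc1 b n" "C \<in> S_tc1 c n" "D \<in> S_tc1 e n"
    by blast
  have adj: "X ** Y = 0 \<or> Y ** X = 0 \<longleftrightarrow> param_adj x y"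
    if "X \<in> S_tc1 x n" "Y \<in> S_tc1 y n" for X Y x y
    using that by (simp add: S_tc1_mult_eq_0_iff param_adj_def)
  assume "A ** B = 0 \<or> B ** A = 0" "B ** C = 0 \<or> C ** B = 0" "C ** D = 0 \<or> D ** C = 0"
  then show "(A ** C = 0 \<or> C ** A = 0) \<or> (B ** D = 0 \<or> D ** B = 0) \<or> (A ** D = 0 \<or> D ** A = 0)"
    using param_adj_P4_free[OF U]
    by (simp only: adj[OF S(1) S(2)] adj[OF S(2) S(3)] adj[OF S(3) S(4)]
        adj[OF S(1) S(3)] adj[OF S(2) S(4)] adj[OF S(1) S(4)])
qed

theorem theorem3p14:
  fixes d n :: nat
  assumes "d = 0 \<or> (d > 0 \<and> squarefree d)"
    and "n \<ge> 1"
  shows "cograph (Gamma1 d n) \<and> cograph (Gamma2_un d n)"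
  using cograph_Gamma1 cograph_Gamma2_un by blast

end
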